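(* Let $f\in C(I\times\mathbb{R}^n\times\mathbb{R}^n,\mathbb{R}^n)$, let $k(t,\sigma,u)\in\mathbb{R}^n$ be continuous for $a\le\sigma\le t<\infty$, $u\in\mathbb{R}^n$, and let $x_0\in\mathbb{R}^n$. Suppose that $$|f(t,u,v)-f(t,\bar u,\bar v)|\le N\big(|u-\bar u|+|v-\bar v|\big)\quad (t\in I,\ u,v,\bar u,\bar v\in\mathbb{R}^n),$$ $$|k(t,\sigma,u)-k(t,\sigma,v)|\le r(t,\sigma)|u-v|\quad ((t,\sigma)\in D,\ u,v\in\mathbb{R}^n),$$ where $0\le N<1$ is a constant and $r\in C(D,\mathbb{R}_+)$, $D=\{(t,\sigma)\in I^2:a\le\sigma\le t<\infty\}$. Let $x$ be a solution on $I$ of $${}^H\mathbb{D}_{a^+}^{\alpha,\beta,\psi}x(t)=f\left(t,x(t),\frac{1}{\Gamma(\alpha)}\int_a^t N_\psi^\alpha(t,\sigma)k(t,\sigma,x(\sigma))\,d\sigma\right),\qquad I_{a^+}^{1-\gamma,\psi}x(a)=x_0 .$$ Then $x$ depends continuously on the functions involved in the right-hand side of this problem, in the following sense. For every $T>a$ and every $\eta>0$ there is $\varepsilon_2>0$ such that the following holds: whenever $\bar f\in C(I\times\mathbb{R}^n\times\mathbb{R}^n,\mathbb{R}^n)$, $\bar k(t,\sigma,u)\in\mathbb{R}^n$ is continuous for $a\le\sigma\le t<\infty$, $u\in\mathbb{R}^n$, $y_0\in\mathbb{R}^n$, and $y$ is a solution on $I$ of $${}^H\mathbb{D}_{a^+}^{\alpha,\beta,\psi}y(t)=\bar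 f\left(t,y(t),\frac{1}{\Gamma(\alpha)}\int_a^t N_\psi^\alpha(t,\sigma)\bar k(t,\sigma,y(\sigma))\,d\sigma\right),\qquad I_{a^+}^{1-\gamma,\psi}y(a)=y_0,$$ such that for all $t>a$ $$\left|\Psi^\gamma(t,a)x_0-\Psi^\gamma(t,a)y_0\right|+I_{a^+}^{\alpha,\psi}\Delta(t)\le\varepsilon_2,$$ where $$\Delta(s)=\left|f\left(s,y(s),\frac{1}{\Gamma(\alpha)}\int_a^s N_\psi^\alpha(s,\sigma)k(s,\sigma,y(\sigma))\,d\sigma\right)-\bar f\left(s,y(s),\frac{1}{\Gamma(\alpha)}\int_a^s N_\psi^\alpha(s,\sigma)\bar k(s,\sigma,y(\sigma))\,d\sigma\right)\right|,$$ one has $\sup_{t\in[a,T]}|x(t)-y(t)|\le\eta$.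
   Context: Let $a\in\mathbb{R}$, $I=[a,\infty)$, $0<\alpha\le 1$, $0\le\beta\le1$, $\gamma=\alpha+\beta(1-\alpha)$, $\mathbb{R}_+=[0,\infty)$, and let $|\cdot|$ be a norm on $\mathbb{R}^n$. The function $\psi:I\to\mathbb{R}$ is increasing, positive on $(a,\infty)$, with continuous derivative $\psi'$ on $I$ and $\psi'(t)\ne 0$ for all $t$. Put $N_\psi^\alpha(t,s)=\psi'(s)(\psi(t)-\psi(s))^{\alpha-1}$ (not to be confused with the constant $N$) and $\Psi^\gamma(t,a)=(\psi(t)-\psi(a))^{\gamma-1}/\Gamma(\gamma)$ for $t>a$. The $\psi$-Riemann-Liouville integral is $I_{a^+}^{\alpha,\psi}g(t)=\frac{1}{\Gamma(\alpha)}\int_a^t N_\psi^\alpha(t,s)g(s)\,ds$ (with $I^{0,\psi}_{a^+}g=g$), and the $\psi$-Hilfer derivative is ${}^H\mathbb{D}_{a^+}^{\alpha,\beta,\psi}x(t)=I_{a^+}^{\beta(1-\alpha),\psi}\left(\frac{1}{\psi'(t)}\frac{d}{dt}\right)I_{a^+}^{(1-\beta)(1-\alpha),\psi}x(t)$, taken componentwise. Meaning of solution: a solution of a problem ${}^H\mathbb{D}_{a^+}^{\alpha,\beta,\psi}x(t)=F(t,x)$, $I_{a^+}^{1-\gamma,\psi}x(a)=x_0$ is a function $x\in C(I,\mathbb{R}^n)$ satisfying the equivalent integral equation $x(t)=\Psi^\gamma(t,a)x_0+I_{a^+}^{\alpha,\psi}\big[F(\cdot,x)\big](t)$ for all $t>a$,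 where $F(s,x)$ denotes the right-hand side of the differential equation evaluated at time $s$ (and similarly for $y$ with $\bar f,\bar k,y_0$). *)

theory Defs
  imports "HOL-Analysis.Analysis"
begin

(* The type class norm on real ^ 'n is the Euclidean one; an arbitrary norm is a function. *)
definition is_norm :: "('a::real_vector \<Rightarrow> real) \<Rightarrow> bool" where
  "is_norm nrm \<longleftrightarrow>
     (\<forall>x. 0 \<le> nrm x) \<and>
     (\<forall>x. nrm x = 0 \<longleftrightarrow> x = 0) \<and>
     (\<forall>c x. nrm (c *\<^sub>R x) = \<bar>c\<bar> * nrm x) \<and>
     (\<forall>x y. nrm (x + y) \<le> nrm x + nrm y)"

(* N_psi^alpha(t,s); psi' is the derivative of psi, passed explicitly because it is one-sided
   at the left end point a.  At s = t the value is 0 by the convention 0 powr z = 0, which does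
   not affect the integrals below. *)
definition psi_kernel :: "(real \<Rightarrow> real) \<Rightarrow> (real \<Rightarrow> real) \<Rightarrow> real \<Rightarrow> real \<Rightarrow> real \<Rightarrow> real" where
  "psi_kernel \<psi> \<psi>' \<alpha> t s = \<psi>' s * (\<psi> t - \<psi> s) powr (\<alpha> - 1)"

definition Psi_pow :: "(real \<Rightarrow> real) \<Rightarrow> real \<Rightarrow> real \<Rightarrow> real \<Rightarrow> real" where
  "Psi_pow \<psi> \<gamma> t a = (\<psi> t - \<psi> a) powr (\<gamma> - 1) / Gamma \<gamma>"

definition psi_RL_integral ::
  "real \<Rightarrow> (real \<Rightarrow> real) \<Rightarrow> (real \<Rightarrow> real) \<Rightarrow> real \<Rightarrow> (real \<Rightarrow> 'a::euclidean_space) \<Rightarrow> real \<Rightarrow> 'a" where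
  "psi_RL_integral a \<psi> \<psi>' \<alpha> g t =
     (if \<alpha> = 0 then g t
      else (1 / Gamma \<alpha>) *\<^sub>R integral {a..t} (\<lambda>s. psi_kernel \<psi> \<psi>' \<alpha> t s *\<^sub>R g s))"

definition hilfer_gamma :: "real \<Rightarrow> real \<Rightarrow> real" where
  "hilfer_gamma \<alpha> \<beta> = \<alpha> + \<beta> * (1 - \<alpha>)"

(* The right-hand side of the integro-differential equation, evaluated along x at time t. *)
definition integro_rhs ::
  "real \<Rightarrow> (real \<Rightarrow> real) \<Rightarrow> (real \<Rightarrow> real) \<Rightarrow> real \<Rightarrow>
   (real \<Rightarrow> 'a::euclidean_space \<Rightarrow> 'a \<Rightarrow> 'a) \<Rightarrow> (real \<Rightarrow> real \<Rightarrow> 'a \<Rightarrow> 'a) \<Rightarrow>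
   (real \<Rightarrow> 'a) \<Rightarrow> real \<Rightarrow> 'a" where
  "integro_rhs a \<psi> \<psi>' \<alpha> f k x t =
     f t (x t)
       ((1 / Gamma \<alpha>) *\<^sub>R
          integral {a..t} (\<lambda>\<sigma>. psi_kernel \<psi> \<psi>' \<alpha> t \<sigma> *\<^sub>R k t \<sigma> (x \<sigma>)))"

(* By definition, a solution on [a, \<infinity>) of the psi-Hilfer problem of order alpha and type beta
   with right-hand side F and datum I^(1 - gamma, psi) x(a) = x0 is a continuous function
   satisfying the Volterra integral equation.  F maps a function to the right-hand side along
   that function. *)
definition hilfer_solution ::
  "real \<Rightarrow> (real \<Rightarrow> real) \<Rightarrow> (real \<Rightarrow> real) \<Rightarrow> real \<Rightarrow> real \<Rightarrow>
   ((real \<Rightarrow> 'a::euclidean_space) \<Rightarrow> real \<Rightarrow> 'a) \<Rightarrow> 'a \<Rightarrow> (real \<Rightarrow> 'a) \<Rightarrow> bool" where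
  "hilfer_solution a \<psi> \<psi>' \<alpha> \<beta> F x0 x \<longleftrightarrow>
     continuous_on {a..} x \<and>
     (\<forall>t>a. x t = Psi_pow \<psi> (hilfer_gamma \<alpha> \<beta>) t a *\<^sub>R x0 + psi_RL_integral a \<psi> \<psi>' \<alpha> (F x) t)"

end

theory Submission
  imports Defs
begin

text \<open>
  Subtracting the two integral equations bounds \<open>e t = |x t - y t|\<close> by the given perturbation plus
  iterated \<open>\<psi>\<close>-Riemann-Liouville integrals of \<open>e\<close>, the kernel \<open>r\<close> being bounded on the compact
  triangle below \<open>T\<close>. In the norm weighted by \<open>exp (- l * (\<psi> t - \<psi> a))\<close> with \<open>l\<close> large these integral
  operators have norm so small that the right-hand side can be absorbed, which gives \<open>e \<le> C \<epsilon>\<close> on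
  \<open>[a, T]\<close> with \<open>C\<close> independent of \<open>y\<close>.
\<close>

section \<open>Continuity of sections, and arbitrary norms on a Euclidean space\<close>

lemma continuous_on_section:
  assumes "continuous_on D (\<lambda>(x, y). F x y)" "\<And>y. y \<in> B \<Longrightarrow> (x, y) \<in> D"
  shows "continuous_on B (F x)"
proof -
  have "continuous_on B (\<lambda>y. case (x, y) of (x, y) \<Rightarrow> F x y)"
    by (rule continuous_on_compose2[OF assms(1)]) (use assms(2) in \<open>auto intro!: continuous_intros\<close>)
  then show ?thesis by simp
qed

text \<open>Expanding \<open>v\<close> in the basis reduces the bound to the finitely many values of
  \<open>nrm\<close> on basis vectors, since each coordinate is at most \<open>norm v\<close>. The
  summand 1 makes the constant visibly positive, so that it can serve as a Lipschitz constant and as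
  a divisor.\<close>

lemma is_norm_bounded:
  fixes nrm :: "'a::euclidean_space \<Rightarrow> real"
  assumes "is_norm nrm"
  obtains C where "0 < C" "\<And>v. nrm v \<le> C * norm v"
proof
  have zero: "nrm 0 = 0" and ge: "\<And>v. 0 \<le> nrm v"
    and scale: "\<And>c v. nrm (c *\<^sub>R v) = \<bar>c\<bar> * nrm v" and tri: "\<And>v w. nrm (v + w) \<le> nrm v + nrm w"
    using assms unfolding is_norm_def by auto
  have sum_le: "nrm (\<Sum>b\<in>B. g b) \<le> (\<Sum>b\<in>B. nrm (g b))" if "finite B" for g :: "'a \<Rightarrow> 'a" and B
    using that by (induction B) (auto simp: zero intro: order_trans[OF tri])
  show "0 < 1 + (\<Sum>b\<in>Basis. nrm (b::'a))"
    by (simp add: add_pos_nonneg sum_nonneg ge)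
  fix v :: 'a
  have "nrm v = nrm (\<Sum>b\<in>Basis. (v \<bullet> b) *\<^sub>R b)"
    by (simp add: euclidean_representation)
  also have "\<dots> \<le> (\<Sum>b\<in>Basis. \<bar>v \<bullet> b\<bar> * nrm b)"
    using sum_le[OF finite_Basis, of "\<lambda>b. (v \<bullet> b) *\<^sub>R b"] by (simp add: scale)
  also have "\<dots> \<le> (\<Sum>b\<in>Basis. norm v * nrm b)"
    by (intro sum_mono mult_right_mono Basis_le_norm ge)
  also have "\<dots> \<le> (1 + (\<Sum>b\<in>Basis. nrm b)) * norm v"
    by (simp add: sum_distrib_left[symmetric] algebra_simps)
  finally show "nrm v \<le> (1 + (\<Sum>b\<in>Basis. nrm b)) * norm v" .
qed

lemma is_norm_diff_ineq:
  assumes "is_norm nrm"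
  shows "nrm v \<le> nrm w + nrm (v - w)"
  using assms unfolding is_norm_def by (metis add.commute diff_add_cancel)

text \<open>The reverse triangle inequality together with \<open>is_norm_bounded\<close> makes
  \<open>nrm\<close> Lipschitz with respect to the class norm.\<close>

lemma is_norm_continuous_on:
  fixes nrm :: "'a::euclidean_space \<Rightarrow> real"
  assumes "is_norm nrm"
  shows "continuous_on S nrm"
proof -
  obtain C where C: "0 < C" "\<And>v. nrm v \<le> C * norm v"
    using is_norm_bounded[OF assms] by blast
  have "\<bar>nrm v - nrm w\<bar> \<le> C * norm (v - w)" for v w
    using is_norm_diff_ineq[OF assms, of v w] is_norm_diff_ineq[OF assms, of w v]
      C(2)[of "v - w"] C(2)[of "w - v"] by (simp add: norm_minus_commute)
  then have "C-lipschitz_on S nrm"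
    using C(1) by (intro lipschitz_onI) (auto simp: dist_norm)
  then show ?thesis
    by (rule lipschitz_on_continuous_on)
qed

text \<open>On every tagged division the triangle inequality bounds \<open>nrm\<close> of the
  Riemann sum of \<open>f\<close> by the Riemann sum of \<open>g\<close>. A division fine for both
  integrals carries this over to the limits, up to an arbitrary \<open>e\<close>.\<close>

lemma is_norm_has_integral_le:
  fixes nrm :: "'b::euclidean_space \<Rightarrow> real" and f :: "'a::euclidean_space \<Rightarrow> 'b"
  assumes nrm: "is_norm nrm"
    and f: "(f has_integral y) (cbox a b)" and g: "(g has_integral z) (cbox a b)"
    and le: "\<And>s. s \<in> cbox a b \<Longrightarrow> nrm (f s) \<le> g s"
  shows "nrm y \<le> z"
proof (rule field_le_epsilon)
  fix e :: real assume "0 < e"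
  have zero: "nrm 0 = 0" and scale: "\<And>c v. nrm (c *\<^sub>R v) = \<bar>c\<bar> * nrm v"
    and tri: "\<And>v w. nrm (v + w) \<le> nrm v + nrm w"
    using nrm unfolding is_norm_def by auto
  have sum_le: "nrm (\<Sum>i\<in>B. h i) \<le> (\<Sum>i\<in>B. nrm (h i))" if "finite B" for h :: "'a \<times> 'a set \<Rightarrow> 'b" and B
    using that by (induction B) (auto simp: zero intro: order_trans[OF tri])
  \<comment> \<open>The Riemann sums of \<open>f\<close> converge in the class norm. The factor
    \<open>C\<close> turns that error into one for \<open>nrm\<close>, whence the tolerance
    \<open>e / (2 * C)\<close> below.\<close>
  obtain C where C: "0 < C" "\<And>v. nrm v \<le> C * norm v"
    using is_norm_bounded[OF nrm] by blast
  from f \<open>0 < e\<close> C(1) obtain \<gamma>1 where \<gamma>1: "gauge \<gamma>1"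
    "\<And>p. p tagged_division_of cbox a b \<Longrightarrow> \<gamma>1 fine p \<Longrightarrow>
       norm ((\<Sum>(s, K)\<in>p. measure lborel K *\<^sub>R f s) - y) < e / (2 * C)"
    unfolding has_integral by (metis divide_pos_pos mult_pos_pos zero_less_numeral)
  from g \<open>0 < e\<close> obtain \<gamma>2 where \<gamma>2: "gauge \<gamma>2"
    "\<And>p. p tagged_division_of cbox a b \<Longrightarrow> \<gamma>2 fine p \<Longrightarrow>
       norm ((\<Sum>(s, K)\<in>p. measure lborel K *\<^sub>R g s) - z) < e / 2"
    unfolding has_integral by (metis half_gt_zero)
  obtain p where p: "p tagged_division_of cbox a b" "(\<lambda>s. \<gamma>1 s \<inter> \<gamma>2 s) fine p"
    using fine_division_exists[OF gauge_Int[OF \<gamma>1(1) \<gamma>2(1)]] by metis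
  define S where "S = (\<Sum>(s, K)\<in>p. measure lborel K *\<^sub>R f s)"
  have "nrm S \<le> (\<Sum>(s, K)\<in>p. nrm (measure lborel K *\<^sub>R f s))"
    using sum_le[OF tagged_division_of_finite[OF p(1)]] unfolding S_def by (simp add: split_def)
  also have "\<dots> \<le> (\<Sum>(s, K)\<in>p. measure lborel K *\<^sub>R g s)"
  proof (intro sum_mono, clarify)
    fix s K assume "(s, K) \<in> p"
    then have "s \<in> cbox a b"
      using tagged_division_ofD(2,3)[OF p(1)] by blast
    then show "nrm (measure lborel K *\<^sub>R f s) \<le> measure lborel K *\<^sub>R g s"
      by (auto simp: scale intro!: mult_left_mono le)
  qed
  also have "\<dots> \<le> z + e / 2"
    using \<gamma>2(2)[OF p(1)] p(2) unfolding fine_Int real_norm_def by argo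
  finally have "nrm S \<le> z + e / 2" .
  moreover have "nrm (y - S) \<le> e / 2"
  proof -
    have "norm (y - S) \<le> e / (2 * C)"
      using \<gamma>1(2)[OF p(1)] p(2) by (auto simp: fine_Int S_def norm_minus_commute)
    then show ?thesis
      using C order_trans[OF C(2)[of "y - S"], of "e / 2"] by (simp add: field_simps)
  qed
  ultimately show "nrm y \<le> z + e"
    using is_norm_diff_ineq[OF nrm, of y S] by linarith
qed

section \<open>The kernel operator: regularising substitution, continuity, contraction\<close>

text \<open>Strict positivity of \<psi>' is what makes \<psi> injective and the kernel nonnegative.
  For the theorem it follows from monotonicity of \<psi> and \<psi>' having no zero, through
  \<open>mono_on_imp_right_deriv_nonneg\<close>.\<close>

locale psi_RL_kernel =
  fixes a \<alpha> :: real and \<psi> \<psi>' :: "real \<Rightarrow> real"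
  assumes alpha_pos: "0 < \<alpha>"
    and psi_deriv: "\<And>t. a \<le> t \<Longrightarrow> (\<psi> has_real_derivative \<psi>' t) (at t within {a..})"
    and psi'_pos: "\<And>t. a \<le> t \<Longrightarrow> 0 < \<psi>' t"
begin

lemma psi_continuous_on: "S \<subseteq> {a..} \<Longrightarrow> continuous_on S \<psi>"
  by (rule continuous_on_subset[of "{a..}"]) (auto intro: DERIV_continuous_on psi_deriv)

lemma psi_less:
  assumes "a \<le> s" "s < t"
  shows "\<psi> s < \<psi> t"
\<comment> \<open>Only interior points are examined, because at \<open>a\<close> the derivative is
  merely one-sided.\<close>
proof (rule DERIV_pos_imp_increasing_open[OF assms(2)])
  fix u assume u: "s < u" "u < t"
  then have "at u within {a..} = at u"
    using assms by (intro at_within_interior) simp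
  then show "\<exists>D. DERIV \<psi> u :> D \<and> 0 < D"
    using psi_deriv[of u] psi'_pos[of u] u assms by (intro exI[of _ "\<psi>' u"]) auto
qed (use assms in \<open>auto intro: psi_continuous_on\<close>)

lemma psi_le: "a \<le> s \<Longrightarrow> s \<le> t \<Longrightarrow> \<psi> s \<le> \<psi> t"
  using psi_less[of s t] by (cases "s = t") auto

lemma inj_on_psi: "inj_on \<psi> {a..}"
  by (rule linorder_inj_onI) (auto dest: psi_less)

text \<open>For \<open>a < t\<close> this is the equation \<open>u = ((\<psi> t - \<psi> s) /
  (\<psi> t - \<psi> a)) powr \<alpha>\<close> solved for \<open>s\<close>: as \<open>u\<close> runs
  from 0 to 1, the node moves from \<open>t\<close> back to \<open>a\<close>. The parameter interval
  is the same for all \<open>t\<close>.\<close>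

definition node :: "real \<Rightarrow> real \<Rightarrow> real" where
  "node t u = inv_into {a..} \<psi> (\<psi> t - u powr (1 / \<alpha>) * (\<psi> t - \<psi> a))"

lemma node_arg_bounds:
  assumes "a \<le> t" "u \<in> {0..1}"
  shows "\<psi> a \<le> \<psi> t - u powr (1 / \<alpha>) * (\<psi> t - \<psi> a)"
    and "\<psi> t - u powr (1 / \<alpha>) * (\<psi> t - \<psi> a) \<le> \<psi> t"
proof -
  have "u powr (1 / \<alpha>) \<le> 1"
    using assms alpha_pos by (intro powr_le1) auto
  then have "u powr (1 / \<alpha>) * (\<psi> t - \<psi> a) \<le> 1 * (\<psi> t - \<psi> a)"
    using psi_le[OF _ assms(1)] by (intro mult_right_mono) auto
  then show "\<psi> a \<le> \<psi> t - u powr (1 / \<alpha>) * (\<psi> t - \<psi> a)" by simp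
  show "\<psi> t - u powr (1 / \<alpha>) * (\<psi> t - \<psi> a) \<le> \<psi> t"
    using psi_le[OF _ assms(1)] by simp
qed

text \<open>The intermediate value theorem provides a preimage between \<open>a\<close> and
  \<open>t\<close>, and injectivity of \<psi> identifies it with the value of
  \<open>inv_into\<close>.\<close>

lemma node:
  assumes "a \<le> t" "u \<in> {0..1}"
  shows "node t u \<in> {a..t}" "\<psi> (node t u) = \<psi> t - u powr (1 / \<alpha>) * (\<psi> t - \<psi> a)"
proof -
  obtain s where s: "a \<le> s" "s \<le> t" "\<psi> s = \<psi> t - u powr (1 / \<alpha>) * (\<psi> t - \<psi> a)"
    using IVT'[OF node_arg_bounds[OF assms] assms(1)] psi_continuous_on by auto
  then have "node t u = s"
    unfolding node_def s(3)[symmetric] by (intro inv_into_f_f[OF inj_on_psi]) simp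
  then show "node t u \<in> {a..t}" "\<psi> (node t u) = \<psi> t - u powr (1 / \<alpha>) * (\<psi> t - \<psi> a)"
    using s by auto
qed

lemma node_substitution:
  assumes "a \<le> s" "s \<le> t" "a < t"
  shows "node t (((\<psi> t - \<psi> s) / (\<psi> t - \<psi> a)) powr \<alpha>) = s"
proof -
  have "0 < \<psi> t - \<psi> a" "\<psi> s \<le> \<psi> t" using assms psi_less[of a t] psi_le[of s t] by auto
  then have "node t (((\<psi> t - \<psi> s) / (\<psi> t - \<psi> a)) powr \<alpha>) = inv_into {a..} \<psi> (\<psi> s)"
    using alpha_pos by (simp add: node_def powr_powr)
  then show ?thesis
    using assms inv_into_f_f[OF inj_on_psi] by simp
qed

text \<open>The inverse of \<psi> is continuous on the image of the compact interval
  \<open>{a..T}\<close>. Its argument contains \<open>\<psi> t - \<psi> a\<close> only as a factor,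
  never as a divisor, so joint continuity extends to \<open>t = a\<close>.\<close>

lemma node_continuous_on:
  "continuous_on ({a..T} \<times> {0..1}) (\<lambda>(t, u). node t u)"
proof -
  have inv: "continuous_on (\<psi> ` {a..T}) (inv_into {a..} \<psi>)"
    by (intro continuous_on_inv psi_continuous_on) (auto simp: inv_into_f_f[OF inj_on_psi])
  have psi: "continuous_on ({a..T} \<times> {0..1::real}) (\<lambda>p. \<psi> (fst p))"
    by (rule continuous_on_compose2[OF psi_continuous_on[of "{a..T}"]]) (auto intro: continuous_intros)
  have arg: "continuous_on ({a..T} \<times> {0..1})
      (\<lambda>p. \<psi> (fst p) - snd p powr (1 / \<alpha>) * (\<psi> (fst p) - \<psi> a))"
    using alpha_pos by (intro continuous_intros psi continuous_on_powr') auto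
  have "\<psi> t - u powr (1 / \<alpha>) * (\<psi> t - \<psi> a) \<in> \<psi> ` {a..T}" if "t \<in> {a..T}" "u \<in> {0..1}" for t u
    using node[of t u] that by (intro image_eqI[where x = "node t u"]) auto
  then have "(\<lambda>p. \<psi> (fst p) - snd p powr (1 / \<alpha>) * (\<psi> (fst p) - \<psi> a)) ` ({a..T} \<times> {0..1}) \<subseteq> \<psi> ` {a..T}"
    by auto
  from continuous_on_compose2[OF inv arg this] show ?thesis
    by (simp add: node_def split_def)
qed

text \<open>The substitution \<open>u = ((\<psi> t - \<psi> s) / (\<psi> t - \<psi> a)) powr \<alpha>\<close> absorbs the singular kernel.\<close>

lemma psi_kernel_has_integral:
  fixes g :: "real \<Rightarrow> 'b::euclidean_space"
  assumes "a \<le> t" and g: "continuous_on {a..t} g"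
  shows "((\<lambda>s. psi_kernel \<psi> \<psi>' \<alpha> t s *\<^sub>R g s) has_integral
    ((\<psi> t - \<psi> a) powr \<alpha> / \<alpha>) *\<^sub>R integral {0..1} (\<lambda>u. g (node t u))) {a..t}"
proof (cases "a = t")
  case True
  then show ?thesis by (simp add: has_integral_refl)
next
  case False
  then have at: "a < t" using assms by simp
  define c where "c = \<psi> t - \<psi> a"
  have c: "0 < c" unfolding c_def using psi_less[OF _ at] by simp
  define \<phi> where "\<phi> = (\<lambda>s. ((\<psi> t - \<psi> s) / c) powr \<alpha>)"
  define \<phi>' where "\<phi>' = (\<lambda>s. - (\<alpha> / c powr \<alpha>) * psi_kernel \<psi> \<psi>' \<alpha> t s)"
  have range: "\<phi> ` {a..t} \<subseteq> {0..1}"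
    using c psi_le alpha_pos by (auto simp: \<phi>_def c_def divide_simps intro!: powr_le1)
  have cont_f: "continuous_on {0..1} (\<lambda>u. g (node t u))"
  proof (rule continuous_on_compose2[OF g])
    show "continuous_on {0..1} (node t)"
      using assms(1) by (intro continuous_on_section[OF node_continuous_on[of t]]) auto
    show "node t ` {0..1} \<subseteq> {a..t}"
      using node[OF assms(1)] by auto
  qed
  have cont_phi: "continuous_on {a..t} \<phi>"
    unfolding \<phi>_def using c alpha_pos psi_le[of _ t]
    by (intro continuous_on_powr' continuous_intros psi_continuous_on) (auto simp: divide_simps)
  \<comment> \<open>At \<open>s = t\<close> the derivative of \<open>\<phi>\<close> may be infinite.
    This single point is the exceptional set allowed by the substitution rule.\<close>
  have deriv: "(\<phi> has_real_derivative \<phi>' s) (at s within {a..t})" if "s \<in> {a..t} - {t}" for s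
  proof -
    have s: "a \<le> s" "s < t" using that by auto
    have pos: "0 < \<psi> t - \<psi> s" using psi_less[OF s] by simp
    have d: "(\<psi> has_real_derivative \<psi>' s) (at s within {a..t})"
      using psi_deriv[OF s(1)] by (rule DERIV_subset) auto
    have "(\<phi> has_real_derivative (\<alpha> * ((\<psi> t - \<psi> s) / c) powr (\<alpha> - 1) * (- \<psi>' s / c))) (at s within {a..t})"
      unfolding \<phi>_def using pos c
      by (auto intro!: derivative_eq_intros d simp: powr_diff field_simps)
    moreover have "\<alpha> * ((\<psi> t - \<psi> s) / c) powr (\<alpha> - 1) * (- \<psi>' s / c) = \<phi>' s"
      using pos c by (simp add: \<phi>'_def psi_kernel_def powr_divide powr_diff field_simps)
    ultimately show ?thesis by simp
  qed
  \<comment> \<open>\<open>\<phi>\<close> decreases from 1 at \<open>a\<close> to 0 at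
    \<open>t\<close>, so the integral over \<open>{0..1}\<close> appears with reversed orientation.
    Its sign cancels against the one in \<open>\<phi>'\<close>.\<close>
  have "((\<lambda>s. \<phi>' s *\<^sub>R g (node t (\<phi> s))) has_integral - integral {0..1} (\<lambda>u. g (node t u))) {a..t}"
  proof -
    have "\<phi> a = 1" "\<phi> t = 0" using c by (auto simp: \<phi>_def c_def)
    then show ?thesis
      using has_integral_substitution_general[of "{t}", OF _ assms(1) range cont_f cont_phi deriv] by simp
  qed
  from has_integral_cmul[OF this, of "- (c powr \<alpha> / \<alpha>)"]
  have "((\<lambda>s. psi_kernel \<psi> \<psi>' \<alpha> t s *\<^sub>R g (node t (\<phi> s))) has_integral
      (c powr \<alpha> / \<alpha>) *\<^sub>R integral {0..1} (\<lambda>u. g (node t u))) {a..t}"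
    using alpha_pos c by (simp add: \<phi>'_def)
  then show ?thesis
    unfolding c_def[symmetric]
    by (rule has_integral_eq[rotated]) (use node_substitution at in \<open>auto simp: \<phi>_def c_def\<close>)
qed

lemma psi_kernel_integrable:
  fixes g :: "real \<Rightarrow> 'b::euclidean_space"
  assumes "a \<le> t" "continuous_on {a..t} g"
  shows "(\<lambda>s. psi_kernel \<psi> \<psi>' \<alpha> t s *\<^sub>R g s) integrable_on {a..t}"
  using psi_kernel_has_integral[OF assms] by blast

lemma psi_kernel_nonneg: "a \<le> s \<Longrightarrow> 0 \<le> psi_kernel \<psi> \<psi>' \<alpha> t s"
  using psi'_pos[of s] by (simp add: psi_kernel_def)

text \<open>After the substitution the integral runs over the fixed interval \<open>{0..1}\<close>,
  and its integrand \<open>p t (node t u)\<close> is jointly continuous. Neither the moving end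
  point nor the singularity is left, and continuity of parameter integrals applies.\<close>

lemma psi_kernel_integral_continuous_on:
  fixes p :: "real \<Rightarrow> real \<Rightarrow> 'b::euclidean_space"
  assumes p: "continuous_on {(t, s). a \<le> s \<and> s \<le> t \<and> t \<le> T} (\<lambda>(t, s). p t s)"
  shows "continuous_on {a..T} (\<lambda>t. integral {a..t} (\<lambda>s. psi_kernel \<psi> \<psi>' \<alpha> t s *\<^sub>R p t s))"
proof -
  have "continuous_on ({a..T} \<times> cbox 0 1) (\<lambda>(t, u). p t (node t u))"
    using continuous_on_compose2[OF p, of "{a..T} \<times> {0..1}" "\<lambda>q. (fst q, node (fst q) (snd q))"]
      node_continuous_on[of T] node(1)
    by (fastforce simp: split_def intro!: continuous_intros)
  from integral_continuous_on_param[OF this]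
  have "continuous_on {a..T} (\<lambda>t. ((\<psi> t - \<psi> a) powr \<alpha> / \<alpha>) *\<^sub>R integral {0..1} (\<lambda>u. p t (node t u)))"
    using alpha_pos psi_le by (intro continuous_intros continuous_on_powr' psi_continuous_on) auto
  then show ?thesis
  proof (rule continuous_on_eq)
    fix t assume t: "t \<in> {a..T}"
    show "((\<psi> t - \<psi> a) powr \<alpha> / \<alpha>) *\<^sub>R integral {0..1} (\<lambda>u. p t (node t u)) =
      integral {a..t} (\<lambda>s. psi_kernel \<psi> \<psi>' \<alpha> t s *\<^sub>R p t s)"
    proof (rule integral_unique[OF psi_kernel_has_integral, symmetric])
      show "a \<le> t" using t by simp
      show "continuous_on {a..t} (p t)"
        using t by (intro continuous_on_section[OF p]) auto
    qed
  qed
qed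

text \<open>For large \<open>l\<close> the kernel operator contracts the norm weighted by \<open>exp (- l * (\<psi> t - \<psi> a))\<close>.\<close>

lemma exponential_weight:
  assumes "0 < q"
  obtains l where "0 \<le> l"
    "\<And>t. t \<in> {a..T} \<Longrightarrow> integral {a..t} (\<lambda>s. psi_kernel \<psi> \<psi>' \<alpha> t s *\<^sub>R exp (l * (\<psi> s - \<psi> a)))
       \<le> q * exp (l * (\<psi> t - \<psi> a))"
proof -
  \<comment> \<open>\<open>c0\<close> is the length in \<psi> at which the unweighted kernel
    integral \<open>c0 powr \<alpha> / \<alpha>\<close> equals \<open>q\<close>.\<close>
  define c0 where "c0 = (\<alpha> * q) powr (1 / \<alpha>)"
  have c0: "0 < c0" "c0 powr \<alpha> = \<alpha> * q"
    using assms alpha_pos by (auto simp: c0_def powr_powr)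
  \<comment> \<open>With \<open>c = \<psi> t - \<psi> a\<close>, the substitution turns the weight
    ratio \<open>exp (l * (\<psi> s - \<psi> t))\<close> into \<open>h (l * c) u\<close>. Thus
    \<open>H (l * c)\<close> measures the gain from the weight.\<close>
  define h where "h = (\<lambda>y u :: real. exp (- (y * u powr (1 / \<alpha>))))"
  define H where "H = (\<lambda>y. integral {0..1} (h y))"
  have h_int: "h y integrable_on {0..1}" for y
    unfolding h_def using alpha_pos
    by (intro integrable_continuous_real continuous_intros continuous_on_powr') auto
  have H_mono: "H z \<le> H y" if "y \<le> z" for y z
    unfolding H_def using h_int that
    by (intro integral_le) (auto simp: h_def intro: mult_right_mono)
  have H_nonneg: "0 \<le> H y" for y
    unfolding H_def by (intro integral_nonneg h_int) (auto simp: h_def)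
  have H_0: "H 0 = 1"
    by (simp add: H_def h_def)
  \<comment> \<open>Dominated convergence with majorant 1: the integrands tend to 0 except at
    \<open>u = 0\<close>, a null set. The rate \<open>l\<close> is taken among the natural numbers
    so that a sequence suffices.\<close>
  have lim: "(\<lambda>n. H (real n * c0)) \<longlonglongrightarrow> 0"
  proof -
    have "(\<lambda>n. integral {0..1} (h (real n * c0))) \<longlonglongrightarrow> integral {0..1} (indicator {0} :: real \<Rightarrow> real)"
    proof (rule dominated_convergence(2)[where h = "\<lambda>_. 1"])
      fix n u assume "u \<in> {0..1::real}"
      then show "norm (h (real n * c0) u) \<le> 1"
        using c0(1) by (simp add: h_def)
    next
      fix u assume u: "u \<in> {0..1::real}"
      show "(\<lambda>n. h (real n * c0) u) \<longlonglongrightarrow> indicator {0} u"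
      proof (cases "u = 0")
        case False
        then have "0 < c0 * u powr (1 / \<alpha>)" using u c0 by simp
        then have "filterlim (\<lambda>n. c0 * u powr (1 / \<alpha>) * real n) at_top sequentially"
          by (rule filterlim_tendsto_pos_mult_at_top[OF tendsto_const _ filterlim_real_sequentially])
        then have "(\<lambda>n. exp (- (c0 * u powr (1 / \<alpha>) * real n))) \<longlonglongrightarrow> 0"
          by (rule filterlim_compose[OF exp_at_bot filterlim_compose[OF filterlim_uminus_at_bot_at_top]])
        then show ?thesis using False by (simp add: h_def mult_ac)
      qed (simp add: h_def)
    qed (auto intro: h_int)
    moreover have "integral {0..1} (indicator {0} :: real \<Rightarrow> real) = 0"
      by (rule integral_unique[OF has_integral_spike[where S = "{0}" and f = "\<lambda>_. 0"]]) auto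
    ultimately show ?thesis by (simp add: H_def)
  qed
  define M where "M = \<psi> T - \<psi> a"
  have "(\<lambda>n. M powr \<alpha> / \<alpha> * H (real n * c0)) \<longlonglongrightarrow> 0"
    by (rule tendsto_mult_right_zero[OF lim])
  then have "eventually (\<lambda>n. M powr \<alpha> / \<alpha> * H (real n * c0) < q) sequentially"
    using assms by (rule order_tendstoD)
  then obtain n where n: "M powr \<alpha> / \<alpha> * H (real n * c0) < q"
    using eventually_happens'[OF sequentially_bot] by blast
  show thesis
  proof
    show "0 \<le> real n" by simp
    fix t assume t: "t \<in> {a..T}"
    define c where "c = \<psi> t - \<psi> a"
    have c: "0 \<le> c" "c \<le> M" using t psi_le by (auto simp: c_def M_def)
    have "integral {a..t} (\<lambda>s. psi_kernel \<psi> \<psi>' \<alpha> t s *\<^sub>R exp (real n * (\<psi> s - \<psi> a))) =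
        (c powr \<alpha> / \<alpha>) *\<^sub>R integral {0..1} (\<lambda>u. exp (real n * (\<psi> (node t u) - \<psi> a)))"
      unfolding c_def using t
      by (intro integral_unique[OF psi_kernel_has_integral] continuous_intros psi_continuous_on) auto
    also have "integral {0..1} (\<lambda>u. exp (real n * (\<psi> (node t u) - \<psi> a))) =
        integral {0..1} (\<lambda>u. exp (real n * c) * h (real n * c) u)"
    proof (rule integral_cong)
      fix u :: real assume "u \<in> {0..1}"
      then have eq: "\<psi> (node t u) - \<psi> a = c - u powr (1 / \<alpha>) * c"
        using t node(2)[of t u] by (simp add: c_def)
      show "exp (real n * (\<psi> (node t u) - \<psi> a)) = exp (real n * c) * h (real n * c) u"
        unfolding eq by (simp add: h_def exp_add[symmetric] algebra_simps)
    qed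
    also have "\<dots> = exp (real n * c) * H (real n * c)"
      by (simp add: H_def)
    finally have eq: "integral {a..t} (\<lambda>s. psi_kernel \<psi> \<psi>' \<alpha> t s *\<^sub>R exp (real n * (\<psi> s - \<psi> a))) =
        (c powr \<alpha> / \<alpha> * H (real n * c)) * exp (real n * c)" by simp
    \<comment> \<open>For small \<open>c\<close> the exponential gains little, but the prefactor is
      already at most \<open>q\<close> and \<open>H\<close> is at most 1. Beyond \<open>c0\<close>
      the prefactor is only bounded by its value at \<open>M\<close>, while \<open>H\<close> is at
      most \<open>H (real n * c0)\<close>, which \<open>n\<close> was chosen to make small.\<close>
    have "c powr \<alpha> / \<alpha> * H (real n * c) \<le> q"
    proof (cases "c \<le> c0")
      case True
      have "c powr \<alpha> / \<alpha> * H (real n * c) \<le> c0 powr \<alpha> / \<alpha> * H 0"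
        using True c alpha_pos H_nonneg
        by (intro mult_mono divide_right_mono powr_mono2 H_mono) auto
      then show ?thesis using c0 alpha_pos by (simp add: H_0)
    next
      case False
      have "c powr \<alpha> / \<alpha> * H (real n * c) \<le> M powr \<alpha> / \<alpha> * H (real n * c0)"
        using False c c0(1) alpha_pos H_nonneg
        by (intro mult_mono divide_right_mono powr_mono2 H_mono) auto
      then show ?thesis using n by simp
    qed
    then show "integral {a..t} (\<lambda>s. psi_kernel \<psi> \<psi>' \<alpha> t s *\<^sub>R exp (real n * (\<psi> s - \<psi> a)))
        \<le> q * exp (real n * (\<psi> t - \<psi> a))"
      unfolding eq c_def[symmetric] by (intro mult_right_mono) auto
  qed
qed

section \<open>A Gronwall inequality for the iterated kernel operator\<close>

lemma psi_kernel_integral_cmult: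
  "integral {a..t} (\<lambda>s. psi_kernel \<psi> \<psi>' \<alpha> t s *\<^sub>R (b * g s))
    = b * integral {a..t} (\<lambda>s. psi_kernel \<psi> \<psi>' \<alpha> t s *\<^sub>R g s)"
  for g :: "real \<Rightarrow> real"
  by (simp add: mult.left_commute flip: integral_mult_right)

lemma psi_kernel_integral_mono:
  fixes g h :: "real \<Rightarrow> real"
  assumes "a \<le> t" "continuous_on {a..t} g" "continuous_on {a..t} h"
    and "\<And>s. s \<in> {a..t} \<Longrightarrow> g s \<le> h s"
  shows "integral {a..t} (\<lambda>s. psi_kernel \<psi> \<psi>' \<alpha> t s *\<^sub>R g s)
    \<le> integral {a..t} (\<lambda>s. psi_kernel \<psi> \<psi>' \<alpha> t s *\<^sub>R h s)"
proof (rule integral_le)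
  fix s assume "s \<in> {a..t}"
  then show "psi_kernel \<psi> \<psi>' \<alpha> t s *\<^sub>R g s \<le> psi_kernel \<psi> \<psi>' \<alpha> t s *\<^sub>R h s"
    using assms(4)[of s] psi_kernel_nonneg[of s t] by (simp add: mult_left_mono)
qed (rule psi_kernel_integrable assms)+

lemma psi_kernel_integral_continuous_on_indep:
  fixes g :: "real \<Rightarrow> 'b::euclidean_space"
  assumes "continuous_on {a..T} g"
  shows "continuous_on {a..T} (\<lambda>t. integral {a..t} (\<lambda>s. psi_kernel \<psi> \<psi>' \<alpha> t s *\<^sub>R g s))"
proof (rule psi_kernel_integral_continuous_on)
  show "continuous_on {(t, s). a \<le> s \<and> s \<le> t \<and> t \<le> T} (\<lambda>(t, s). g s)"
    unfolding split_def by (rule continuous_on_compose2[OF assms]) (auto intro!: continuous_intros)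
qed

text \<open>In the weighted supremum norm the integral term costs at most half of the norm of
  \<open>e\<close> and can be absorbed. \<open>C\<close> is fixed before \<epsilon> and
  \<open>e\<close>; this uniformity is what later allows the tolerance to be chosen before the
  perturbed problem. The inequality is assumed only for \<open>t > a\<close>, as the integral
  equation is, and the conclusion reaches \<open>a\<close> by continuity.\<close>

lemma iterated_gronwall:
  fixes A B :: real
  assumes A: "0 \<le> A" and B: "0 \<le> B" and T: "a < T"
  shows "\<exists>C>0. \<forall>\<epsilon> e. 0 \<le> \<epsilon> \<longrightarrow> continuous_on {a..T} e \<longrightarrow> (\<forall>t\<in>{a..T}. 0 \<le> e t) \<longrightarrow>
      (\<forall>t\<in>{a<..T}. e t \<le> \<epsilon> + A * integral {a..t} (\<lambda>s. psi_kernel \<psi> \<psi>' \<alpha> t s *\<^sub>R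
          (e s + B * integral {a..s} (\<lambda>\<sigma>. psi_kernel \<psi> \<psi>' \<alpha> s \<sigma> *\<^sub>R e \<sigma>)))) \<longrightarrow>
      (\<forall>t\<in>{a..T}. e t \<le> C * \<epsilon>)"
proof -
  let ?J = "\<lambda>g t. integral {a..t} (\<lambda>s. psi_kernel \<psi> \<psi>' \<alpha> t s *\<^sub>R (g s :: real))"
  \<comment> \<open>One application of the kernel operator costs a factor \<open>q\<close> and two
    cost \<open>q * q\<close>. This \<open>q\<close> keeps the total
    \<open>A * ((1 + B * q) * q)\<close> at most 1/2.\<close>
  define q where "q = 1 / (2 * (A + 1) * (B + 1))"
  have "1 * 1 \<le> (A + 1) * (B + 1)"
    using A B by (intro mult_mono) auto
  then have "1 \<le> 2 * (A + 1) * (B + 1)" by argo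
  then have q: "0 < q" "q \<le> 1"
    unfolding q_def by (simp_all add: divide_le_eq)
  have "A * ((1 + B * q) * q) \<le> (A + 1) * ((B + 1) * q)"
    using A B q mult_left_le[of q B] by (intro mult_mono) auto
  also have "\<dots> = 1 / 2"
    using A B by (simp add: q_def)
  finally have Aq: "A * ((1 + B * q) * q) \<le> 1 / 2" .
  obtain l where l: "0 \<le> l"
    "\<And>t. t \<in> {a..T} \<Longrightarrow> ?J (\<lambda>s. exp (l * (\<psi> s - \<psi> a))) t \<le> q * exp (l * (\<psi> t - \<psi> a))"
    using exponential_weight[OF q(1), of T] by blast
  define w where "w = (\<lambda>t. exp (l * (\<psi> t - \<psi> a)))"
  have Jw: "?J w t \<le> q * w t" if "t \<in> {a..T}" for t
    using l(2)[OF that] by (simp add: w_def)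
  have w_pos: "0 < w t" for t by (simp add: w_def)
  have w_ge_1: "1 \<le> w t" if "a \<le> t" for t
    using l(1) psi_le[OF _ that] by (simp add: w_def)
  have w_cont: "continuous_on S w" if "S \<subseteq> {a..}" for S
    unfolding w_def by (intro continuous_intros psi_continuous_on that)
  show ?thesis
  \<comment> \<open>The argument yields \<open>e t \<le> m * w t\<close> with
    \<open>m \<le> 2 * \<epsilon>\<close>, and \<open>w\<close> is largest at
    \<open>T\<close>.\<close>
  proof (intro exI[of _ "2 * w T"] conjI allI impI ballI)
    show "0 < 2 * w T" using w_pos by simp
    fix \<epsilon> e t
    assume eps: "0 \<le> \<epsilon>" and e: "continuous_on {a..T} e" and e_nonneg: "\<forall>t\<in>{a..T}. 0 \<le> e t"
      and ineq: "\<forall>t\<in>{a<..T}. e t \<le> \<epsilon> + A * ?J (\<lambda>s. e s + B * ?J e s) t"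
      and t: "t \<in> {a..T}"
    have cont: "continuous_on {a..T} (\<lambda>t. e t / w t)"
      using w_pos by (intro continuous_intros e w_cont) (auto simp: less_imp_neq[symmetric])
    obtain t0 where t0: "t0 \<in> {a..T}" "\<And>t. t \<in> {a..T} \<Longrightarrow> e t / w t \<le> e t0 / w t0"
      using continuous_attains_sup[OF compact_Icc _ cont] T by auto
    \<comment> \<open>\<open>m\<close> is the weighted supremum norm of \<open>e\<close> on
      \<open>{a..T}\<close>, attained at \<open>t0\<close>.\<close>
    define m where "m = e t0 / w t0"
    have m: "0 \<le> m"
      unfolding m_def by (intro divide_nonneg_pos bspec[OF e_nonneg] t0(1) w_pos)
    have e_le: "e t \<le> m * w t" if "t \<in> {a..T}" for t
      using t0(2)[OF that] w_pos[of t] by (simp add: m_def divide_le_eq)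
    have J_scale: "?J (\<lambda>s. b * w s) s \<le> b * (q * w s)" if "s \<in> {a..T}" "0 \<le> b" for s b
      unfolding psi_kernel_integral_cmult by (intro mult_left_mono Jw that)
    have Je: "?J e s \<le> m * (q * w s)" if s: "s \<in> {a..T}" for s
    proof -
      have "?J e s \<le> ?J (\<lambda>s. m * w s) s"
        using s e_le by (intro psi_kernel_integral_mono continuous_intros w_cont continuous_on_subset[OF e]) auto
      then show ?thesis using J_scale[OF s m] by simp
    qed
    have Je_cont: "continuous_on {a..T} (?J e)"
      by (rule psi_kernel_integral_continuous_on_indep[OF e])
    have "e t / w t \<le> \<epsilon> + m / 2" if t: "t \<in> {a<..T}" for t
    proof -
      have t': "t \<in> {a..T}" using t by simp
      have "?J (\<lambda>s. e s + B * ?J e s) t \<le> ?J (\<lambda>s. (m * (1 + B * q)) * w s) t"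
      proof (rule psi_kernel_integral_mono)
        show "continuous_on {a..t} (\<lambda>s. e s + B * ?J e s)"
          using t by (intro continuous_on_subset[of "{a..T}" _ "{a..t}"] continuous_intros e Je_cont) auto
        fix s assume "s \<in> {a..t}"
        then have s: "s \<in> {a..T}" using t by auto
        have "e s + B * ?J e s \<le> m * w s + B * (m * (q * w s))"
          using s B by (intro add_mono mult_left_mono e_le Je)
        then show "e s + B * ?J e s \<le> (m * (1 + B * q)) * w s" by (simp add: algebra_simps)
      qed (use t in \<open>auto intro!: continuous_intros w_cont\<close>)
      also have "\<dots> \<le> (m * (1 + B * q)) * (q * w t)"
        using t' m B q by (intro J_scale) auto
      finally have "A * ?J (\<lambda>s. e s + B * ?J e s) t \<le> A * ((m * (1 + B * q)) * (q * w t))"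
        using A by (rule mult_left_mono)
      also have "\<dots> = (A * ((1 + B * q) * q)) * (m * w t)" by (simp add: mult_ac)
      also have "\<dots> \<le> 1 / 2 * (m * w t)"
        using Aq m w_pos[of t] by (intro mult_right_mono) auto
      finally have *: "e t \<le> \<epsilon> + m / 2 * w t" using bspec[OF ineq t] by simp
      \<comment> \<open>Since the weight is at least 1, dividing the inequality by it does not
        enlarge \<epsilon>.\<close>
      have "\<epsilon> * 1 \<le> \<epsilon> * w t" using t eps by (intro mult_left_mono w_ge_1) auto
      then show ?thesis using * w_pos[of t] by (simp add: divide_le_eq algebra_simps)
    qed
    \<comment> \<open>The maximum point \<open>t0\<close> may be \<open>a\<close> itself, where the
      inequality is not assumed; continuity extends the bound to the closure.\<close>
    moreover have "closure {a<..T} = {a..T}" using T by simp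
    ultimately have "m \<le> \<epsilon> + m / 2"
      using continuous_le_on_closure[of "{a<..T}" "\<lambda>t. e t / w t" t0] cont t0(1) by (auto simp: m_def)
    then have "m \<le> 2 * \<epsilon>" by simp
    then have "m * w t \<le> 2 * \<epsilon> * w T"
    proof (rule mult_mono)
      show "w t \<le> w T"
        using t l(1) psi_le[of t T] by (simp add: w_def mult_left_mono)
    qed (use eps w_pos[of t] in auto)
    then show "e t \<le> 2 * w T * \<epsilon>"
      using e_le[OF t] by (simp add: mult_ac)
  qed
qed

section \<open>Continuity and Lipschitz estimates for the right-hand side\<close>

text \<open>The inner integrand \<open>k t s (x s)\<close> is continuous on the triangle, so
  \<open>psi_kernel_integral_continuous_on\<close> makes the last argument of \<open>f\<close>
  continuous in \<open>t\<close>. This continuity is what makes the outer kernel integrals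
  exist.\<close>

lemma integro_rhs_continuous_on:
  fixes x :: "real \<Rightarrow> 'b::euclidean_space"
  assumes f: "continuous_on ({a..} \<times> UNIV \<times> UNIV) (\<lambda>(t, u, v). f t u v)"
    and k: "continuous_on {(t, \<sigma>, u). a \<le> \<sigma> \<and> \<sigma> \<le> t} (\<lambda>(t, \<sigma>, u). k t \<sigma> u)"
    and x: "continuous_on {a..} x"
  shows "continuous_on {a..T} (integro_rhs a \<psi> \<psi>' \<alpha> f k x)"
proof -
  have "continuous_on {(t, s). a \<le> s \<and> s \<le> t \<and> t \<le> T} (\<lambda>q. x (snd q))"
    by (rule continuous_on_compose2[OF x]) (auto intro!: continuous_intros)
  then have "continuous_on {(t, s). a \<le> s \<and> s \<le> t \<and> t \<le> T} (\<lambda>q. (fst q, snd q, x (snd q)))"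
    by (intro continuous_intros)
  then have "continuous_on {(t, s). a \<le> s \<and> s \<le> t \<and> t \<le> T}
      (\<lambda>q. case (fst q, snd q, x (snd q)) of (t, \<sigma>, u) \<Rightarrow> k t \<sigma> u)"
    by (rule continuous_on_compose2[OF k]) auto
  then have "continuous_on {(t, s). a \<le> s \<and> s \<le> t \<and> t \<le> T} (\<lambda>(t, s). k t s (x s))"
    by (simp add: split_def)
  then have "continuous_on {a..T} (\<lambda>t. (t, x t, (1 / Gamma \<alpha>) *\<^sub>R
      integral {a..t} (\<lambda>s. psi_kernel \<psi> \<psi>' \<alpha> t s *\<^sub>R k t s (x s))))"
    by (intro continuous_intros psi_kernel_integral_continuous_on continuous_on_subset[OF x]) auto
  then have "continuous_on {a..T} (\<lambda>t. case (t, x t, (1 / Gamma \<alpha>) *\<^sub>R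
      integral {a..t} (\<lambda>s. psi_kernel \<psi> \<psi>' \<alpha> t s *\<^sub>R k t s (x s))) of (t, u, v) \<Rightarrow> f t u v)"
    by (rule continuous_on_compose2[OF f]) auto
  then show ?thesis
    by (simp add: integro_rhs_def[abs_def])
qed

text \<open>The kernel is nonnegative, so it passes through \<open>nrm\<close> by homogeneity, and
  \<open>is_norm_has_integral_le\<close> applies.\<close>

lemma is_norm_psi_kernel_integral_le:
  fixes nrm :: "'b::euclidean_space \<Rightarrow> real"
  assumes "is_norm nrm" "a \<le> t" "continuous_on {a..t} g" "continuous_on {a..t} h"
    and "\<And>s. s \<in> {a..t} \<Longrightarrow> nrm (g s) \<le> h s"
  shows "nrm (integral {a..t} (\<lambda>s. psi_kernel \<psi> \<psi>' \<alpha> t s *\<^sub>R g s))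
    \<le> integral {a..t} (\<lambda>s. psi_kernel \<psi> \<psi>' \<alpha> t s *\<^sub>R h s)"
proof (rule is_norm_has_integral_le[OF assms(1)])
  show "((\<lambda>s. psi_kernel \<psi> \<psi>' \<alpha> t s *\<^sub>R g s) has_integral
      integral {a..t} (\<lambda>s. psi_kernel \<psi> \<psi>' \<alpha> t s *\<^sub>R g s)) (cbox a t)"
    "((\<lambda>s. psi_kernel \<psi> \<psi>' \<alpha> t s *\<^sub>R h s) has_integral
      integral {a..t} (\<lambda>s. psi_kernel \<psi> \<psi>' \<alpha> t s *\<^sub>R h s)) (cbox a t)"
    unfolding cbox_interval by (intro integrable_integral psi_kernel_integrable assms)+
  fix s assume "s \<in> cbox a t"
  then have "nrm (g s) \<le> h s" "0 \<le> psi_kernel \<psi> \<psi>' \<alpha> t s"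
    using assms(5) psi_kernel_nonneg by auto
  then show "nrm (psi_kernel \<psi> \<psi>' \<alpha> t s *\<^sub>R g s) \<le> psi_kernel \<psi> \<psi>' \<alpha> t s *\<^sub>R h s"
    using assms(1) by (simp add: is_norm_def mult_left_mono)
qed

lemma psi_kernel_integral_diff:
  fixes g h :: "real \<Rightarrow> 'b::euclidean_space"
  assumes "a \<le> t" "continuous_on {a..t} g" "continuous_on {a..t} h"
  shows "integral {a..t} (\<lambda>s. psi_kernel \<psi> \<psi>' \<alpha> t s *\<^sub>R g s)
      - integral {a..t} (\<lambda>s. psi_kernel \<psi> \<psi>' \<alpha> t s *\<^sub>R h s)
    = integral {a..t} (\<lambda>s. psi_kernel \<psi> \<psi>' \<alpha> t s *\<^sub>R (g s - h s))"
  using assms by (simp add: integral_diff[symmetric] psi_kernel_integrable scaleR_diff_right)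

text \<open>The bound for \<open>k\<close> passes through the inner kernel integral, and then
  through the Lipschitz condition of \<open>f\<close>. The result has the form of the integrand in
  \<open>iterated_gronwall\<close>; a constant \<open>R\<close> in place of the function
  \<open>r\<close> allows it to be taken out of the integral.\<close>

lemma integro_rhs_lipschitz:
  fixes x y :: "real \<Rightarrow> 'b::euclidean_space"
  assumes nrm: "is_norm nrm" and t: "a \<le> t" and N: "0 \<le> N"
    and k: "continuous_on {(t, \<sigma>, u). a \<le> \<sigma> \<and> \<sigma> \<le> t} (\<lambda>(t, \<sigma>, u). k t \<sigma> u)"
    and f_lipschitz: "\<And>u v u' v'. nrm (f t u v - f t u' v') \<le> N * (nrm (u - u') + nrm (v - v'))"
    and k_lipschitz: "\<And>\<sigma> u v. \<sigma> \<in> {a..t} \<Longrightarrow> nrm (k t \<sigma> u - k t \<sigma> v) \<le> R * nrm (u - v)"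
    and x: "continuous_on {a..} x" and y: "continuous_on {a..} y"
  shows "nrm (integro_rhs a \<psi> \<psi>' \<alpha> f k x t - integro_rhs a \<psi> \<psi>' \<alpha> f k y t)
    \<le> N * (nrm (x t - y t) + R / Gamma \<alpha> *
        integral {a..t} (\<lambda>s. psi_kernel \<psi> \<psi>' \<alpha> t s *\<^sub>R nrm (x s - y s)))"
proof -
  let ?J = "\<lambda>g. integral {a..t} (\<lambda>s. psi_kernel \<psi> \<psi>' \<alpha> t s *\<^sub>R g s)"
  have k_cont: "continuous_on {a..t} (\<lambda>s. k t s (z s))" if "continuous_on {a..} z" for z
  proof -
    have "continuous_on {a..t} (\<lambda>s. (t, s, z s))"
      by (intro continuous_intros continuous_on_subset[OF that]) auto
    then have "continuous_on {a..t} (\<lambda>s. case (t, s, z s) of (t, \<sigma>, u) \<Rightarrow> k t \<sigma> u)"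
      by (rule continuous_on_compose2[OF k]) auto
    then show ?thesis by simp
  qed
  have e_cont: "continuous_on {a..t} (\<lambda>s. nrm (x s - y s))"
    by (intro continuous_on_compose2[OF is_norm_continuous_on[OF nrm, of UNIV]] continuous_intros
        continuous_on_subset[OF x] continuous_on_subset[OF y]) auto
  have Gamma_pos: "0 < Gamma \<alpha>"
    using alpha_pos by (rule Gamma_real_pos)
  have "nrm (?J (\<lambda>s. k t s (x s)) - ?J (\<lambda>s. k t s (y s))) = nrm (?J (\<lambda>s. k t s (x s) - k t s (y s)))"
    by (simp only: psi_kernel_integral_diff[OF t k_cont[OF x] k_cont[OF y]])
  also have "\<dots> \<le> ?J (\<lambda>s. R * nrm (x s - y s))"
    by (intro is_norm_psi_kernel_integral_le nrm t k_lipschitz continuous_intros k_cont x y e_cont)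
  also have "\<dots> = R * ?J (\<lambda>s. nrm (x s - y s))"
    by (rule psi_kernel_integral_cmult)
  finally have "nrm ((1 / Gamma \<alpha>) *\<^sub>R ?J (\<lambda>s. k t s (x s)) - (1 / Gamma \<alpha>) *\<^sub>R ?J (\<lambda>s. k t s (y s)))
      \<le> R / Gamma \<alpha> * ?J (\<lambda>s. nrm (x s - y s))"
    using nrm Gamma_pos
    by (simp add: is_norm_def divide_right_mono flip: scaleR_diff_right)
  then have "N * (nrm (x t - y t) +
        nrm ((1 / Gamma \<alpha>) *\<^sub>R ?J (\<lambda>s. k t s (x s)) - (1 / Gamma \<alpha>) *\<^sub>R ?J (\<lambda>s. k t s (y s))))
      \<le> N * (nrm (x t - y t) + R / Gamma \<alpha> * ?J (\<lambda>s. nrm (x s - y s)))"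
    using N by (intro mult_left_mono add_left_mono)
  then show ?thesis
    unfolding integro_rhs_def by (rule order_trans[OF f_lipschitz])
qed

end

section \<open>Sign of the derivative of \<psi>, and the continuous dependence theorem\<close>

text \<open>Difference quotients of a monotone function are nonnegative on both sides of
  \<open>t\<close>. Points to the right of \<open>t\<close> always lie in \<open>{a..}\<close>, so
  the limit is nontrivial even at \<open>t = a\<close>.\<close>

lemma mono_on_imp_right_deriv_nonneg:
  fixes a t :: real
  assumes "mono_on {a..} f" "a \<le> t" "(f has_real_derivative D) (at t within {a..})"
  shows "0 \<le> D"
proof (rule tendsto_lowerbound)
  show "((\<lambda>y. (f y - f t) / (y - t)) \<longlongrightarrow> D) (at t within {a..})"
    using assms(3) by (simp add: has_field_derivative_iff)
  show "eventually (\<lambda>y. 0 \<le> (f y - f t) / (y - t)) (at t within {a..})"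
    unfolding eventually_at_filter
  proof (intro always_eventually allI impI)
    fix y assume "y \<in> {a..}"
    then show "0 \<le> (f y - f t) / (y - t)"
      using mono_onD[OF assms(1), of y t] mono_onD[OF assms(1), of t y] assms(2)
      by (cases "y \<le> t") (auto simp: divide_nonpos_nonpos)
  qed
  have "at t within {t<..} \<le> at t within {a..}"
    using assms(2) by (intro at_le) auto
  then show "at t within {a..} \<noteq> bot"
    using trivial_limit_at_right_real[of t] by (metis bot.extremum_uniqueI)
qed

theorem theorem8:
  fixes a \<alpha> \<beta> \<gamma> N :: real
    and \<psi> \<psi>' :: "real \<Rightarrow> real"
    and nrm :: "real ^ 'n \<Rightarrow> real"
    and f :: "real \<Rightarrow> real ^ 'n \<Rightarrow> real ^ 'n \<Rightarrow> real ^ 'n"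
    and k :: "real \<Rightarrow> real \<Rightarrow> real ^ 'n \<Rightarrow> real ^ 'n"
    and r :: "real \<Rightarrow> real \<Rightarrow> real"
    and x0 :: "real ^ 'n"
    and x :: "real \<Rightarrow> real ^ 'n"
  assumes alpha: "0 < \<alpha>" "\<alpha> \<le> 1"
    and beta: "0 \<le> \<beta>" "\<beta> \<le> 1"
    and gamma: "\<gamma> = hilfer_gamma \<alpha> \<beta>"
    and nrm: "is_norm nrm"
    and psi_mono: "mono_on {a..} \<psi>"
    and psi_pos: "\<And>t. t > a \<Longrightarrow> \<psi> t > 0"
    and psi_deriv: "\<And>t. t \<ge> a \<Longrightarrow> (\<psi> has_real_derivative \<psi>' t) (at t within {a..})"
    and psi'_cont: "continuous_on {a..} \<psi>'"
    and psi'_nz: "\<And>t. t \<ge> a \<Longrightarrow> \<psi>' t \<noteq> 0"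
    and f_cont: "continuous_on ({a..} \<times> UNIV \<times> UNIV) (\<lambda>(t, u, v). f t u v)"
    and k_cont: "continuous_on {(t, \<sigma>, u). a \<le> \<sigma> \<and> \<sigma> \<le> t} (\<lambda>(t, \<sigma>, u). k t \<sigma> u)"
    and f_lipschitz: "\<And>t u v u' v'. t \<ge> a \<Longrightarrow>
          nrm (f t u v - f t u' v') \<le> N * (nrm (u - u') + nrm (v - v'))"
    and k_lipschitz: "\<And>t \<sigma> u v. a \<le> \<sigma> \<Longrightarrow> \<sigma> \<le> t \<Longrightarrow>
          nrm (k t \<sigma> u - k t \<sigma> v) \<le> r t \<sigma> * nrm (u - v)"
    and N: "0 \<le> N" "N < 1"
    and r_cont: "continuous_on {(t, \<sigma>). a \<le> \<sigma> \<and> \<sigma> \<le> t} (\<lambda>(t, \<sigma>). r t \<sigma>)"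
    and r_nonneg: "\<And>t \<sigma>. a \<le> \<sigma> \<Longrightarrow> \<sigma> \<le> t \<Longrightarrow> 0 \<le> r t \<sigma>"
    and x_sol: "hilfer_solution a \<psi> \<psi>' \<alpha> \<beta> (integro_rhs a \<psi> \<psi>' \<alpha> f k) x0 x"
  shows "\<forall>T>a. \<forall>\<eta>>0. \<exists>\<epsilon>\<^sub>2>0.
    \<forall>(f' :: real \<Rightarrow> real ^ 'n \<Rightarrow> real ^ 'n \<Rightarrow> real ^ 'n)
     (k' :: real \<Rightarrow> real \<Rightarrow> real ^ 'n \<Rightarrow> real ^ 'n)
     (y0 :: real ^ 'n) (y :: real \<Rightarrow> real ^ 'n).
      continuous_on ({a..} \<times> UNIV \<times> UNIV) (\<lambda>(t, u, v). f' t u v) \<longrightarrow>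
      continuous_on {(t, \<sigma>, u). a \<le> \<sigma> \<and> \<sigma> \<le> t} (\<lambda>(t, \<sigma>, u). k' t \<sigma> u) \<longrightarrow>
      hilfer_solution a \<psi> \<psi>' \<alpha> \<beta> (integro_rhs a \<psi> \<psi>' \<alpha> f' k') y0 y \<longrightarrow>
      (\<forall>t>a. nrm (Psi_pow \<psi> \<gamma> t a *\<^sub>R x0 - Psi_pow \<psi> \<gamma> t a *\<^sub>R y0)
        + psi_RL_integral a \<psi> \<psi>' \<alpha>
            (\<lambda>s. nrm (integro_rhs a \<psi> \<psi>' \<alpha> f k y s - integro_rhs a \<psi> \<psi>' \<alpha> f' k' y s)) t
        \<le> \<epsilon>\<^sub>2) \<longrightarrow>
      (SUP t\<in>{a..T}. nrm (x t - y t)) \<le> \<eta>"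
proof (intro allI impI)
  fix T \<eta> :: real assume T: "a < T" and \<eta>: "0 < \<eta>"
  interpret psi_RL_kernel a \<alpha> \<psi> \<psi>'
  proof
    fix t assume t: "a \<le> t"
    show "0 < \<psi>' t"
      using mono_on_imp_right_deriv_nonneg[OF psi_mono t psi_deriv[OF t]] psi'_nz[OF t] by simp
  qed (use alpha psi_deriv in auto)
  let ?J = "\<lambda>g t. integral {a..t} (\<lambda>s. psi_kernel \<psi> \<psi>' \<alpha> t s *\<^sub>R (g s :: real))"
  have Gamma_pos: "0 < Gamma \<alpha>"
    using alpha by (intro Gamma_real_pos)
  have RL: "psi_RL_integral a \<psi> \<psi>' \<alpha> g t
      = (1 / Gamma \<alpha>) *\<^sub>R integral {a..t} (\<lambda>s. psi_kernel \<psi> \<psi>' \<alpha> t s *\<^sub>R g s)"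
    for g :: "real \<Rightarrow> 'b::euclidean_space" and t
    using alpha by (simp add: psi_RL_integral_def)
  \<comment> \<open>The continuous function \<open>r\<close> is bounded on the compact triangle
    below \<open>T\<close>.\<close>
  obtain R where R: "0 \<le> R" "\<And>t \<sigma>. a \<le> \<sigma> \<Longrightarrow> \<sigma> \<le> t \<Longrightarrow> t \<le> T \<Longrightarrow> r t \<sigma> \<le> R"
  proof -
    let ?D = "{(t, \<sigma>). a \<le> \<sigma> \<and> \<sigma> \<le> t \<and> t \<le> T}"
    have "?D = ({a..T} \<times> {a..T}) \<inter> {p. snd p \<le> fst p}" by auto
    moreover have "compact (({a..T} \<times> {a..T}) \<inter> {p. snd p \<le> fst p})"
      by (intro compact_Int_closed compact_Times compact_Icc closed_Collect_le continuous_intros)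
    ultimately have "compact ?D" by simp
    moreover have "continuous_on ?D (\<lambda>(t, \<sigma>). r t \<sigma>)"
      by (rule continuous_on_subset[OF r_cont]) auto
    ultimately have "bounded ((\<lambda>(t, \<sigma>). r t \<sigma>) ` ?D)"
      by (intro compact_imp_bounded compact_continuous_image)
    then obtain B where B: "\<forall>z\<in>(\<lambda>(t, \<sigma>). r t \<sigma>) ` ?D. norm z \<le> B"
      unfolding bounded_iff ..
    have "r t \<sigma> \<le> \<bar>B\<bar>" if "a \<le> \<sigma>" "\<sigma> \<le> t" "t \<le> T" for t \<sigma>
    proof -
      have "norm (r t \<sigma>) \<le> B"
        using that by (intro bspec[OF B] image_eqI[where x = "(t, \<sigma>)"]) auto
      then show ?thesis by simp
    qed
    then show thesis
      by (intro that[of "\<bar>B\<bar>"]) auto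
  qed
  have coeffs: "0 \<le> N / Gamma \<alpha>" "0 \<le> R / Gamma \<alpha>"
    using N R Gamma_pos by auto
  obtain C where C: "0 < C"
    "\<forall>\<epsilon> e. 0 \<le> \<epsilon> \<longrightarrow> continuous_on {a..T} e \<longrightarrow> (\<forall>t\<in>{a..T}. 0 \<le> e t) \<longrightarrow>
      (\<forall>t\<in>{a<..T}. e t \<le> \<epsilon> + N / Gamma \<alpha> * ?J (\<lambda>s. e s + R / Gamma \<alpha> * ?J e s) t) \<longrightarrow>
      (\<forall>t\<in>{a..T}. e t \<le> C * \<epsilon>)"
    using iterated_gronwall[OF coeffs T] by (elim exE conjE) (rule that)
  show "\<exists>\<epsilon>\<^sub>2>0. \<forall>f' k' y0 y.
      continuous_on ({a..} \<times> UNIV \<times> UNIV) (\<lambda>(t, u, v). f' t u v) \<longrightarrow>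
      continuous_on {(t, \<sigma>, u). a \<le> \<sigma> \<and> \<sigma> \<le> t} (\<lambda>(t, \<sigma>, u). k' t \<sigma> u) \<longrightarrow>
      hilfer_solution a \<psi> \<psi>' \<alpha> \<beta> (integro_rhs a \<psi> \<psi>' \<alpha> f' k') y0 y \<longrightarrow>
      (\<forall>t>a. nrm (Psi_pow \<psi> \<gamma> t a *\<^sub>R x0 - Psi_pow \<psi> \<gamma> t a *\<^sub>R y0)
        + psi_RL_integral a \<psi> \<psi>' \<alpha>
            (\<lambda>s. nrm (integro_rhs a \<psi> \<psi>' \<alpha> f k y s - integro_rhs a \<psi> \<psi>' \<alpha> f' k' y s)) t
        \<le> \<epsilon>\<^sub>2) \<longrightarrow>
      (SUP t\<in>{a..T}. nrm (x t - y t)) \<le> \<eta>"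
  \<comment> \<open>The Gronwall constant \<open>C\<close> depends only on the kernel,
    \<open>N\<close>, \<open>R\<close> and \<open>T\<close>, so this tolerance is fixed before the
    perturbed problem is given.\<close>
  proof (intro exI[of _ "\<eta> / C"] conjI allI impI)
    show "0 < \<eta> / C" using \<eta> C(1) by simp
    fix f' :: "real \<Rightarrow> real ^ 'n \<Rightarrow> real ^ 'n \<Rightarrow> real ^ 'n"
      and k' :: "real \<Rightarrow> real \<Rightarrow> real ^ 'n \<Rightarrow> real ^ 'n"
      and y0 :: "real ^ 'n" and y :: "real \<Rightarrow> real ^ 'n"
    let ?F = "integro_rhs a \<psi> \<psi>' \<alpha> f k" and ?F' = "integro_rhs a \<psi> \<psi>' \<alpha> f' k'"
    assume f'_cont: "continuous_on ({a..} \<times> UNIV \<times> UNIV) (\<lambda>(t, u, v). f' t u v)"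
      and k'_cont: "continuous_on {(t, \<sigma>, u). a \<le> \<sigma> \<and> \<sigma> \<le> t} (\<lambda>(t, \<sigma>, u). k' t \<sigma> u)"
      and y_sol: "hilfer_solution a \<psi> \<psi>' \<alpha> \<beta> ?F' y0 y"
      and close: "\<forall>t>a. nrm (Psi_pow \<psi> \<gamma> t a *\<^sub>R x0 - Psi_pow \<psi> \<gamma> t a *\<^sub>R y0)
        + psi_RL_integral a \<psi> \<psi>' \<alpha> (\<lambda>s. nrm (?F y s - ?F' y s)) t \<le> \<eta> / C"
    have x: "continuous_on {a..} x" and y: "continuous_on {a..} y"
      using x_sol y_sol by (auto simp: hilfer_solution_def)
    have Fx: "continuous_on {a..t} (?F x)" and Fy: "continuous_on {a..t} (?F y)"
      and F'y: "continuous_on {a..t} (?F' y)" for t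
      by (rule integro_rhs_continuous_on; fact)+
    have nrm_cont: "continuous_on S (\<lambda>t. nrm (g t))" if "continuous_on S g" for S :: "real set" and g
      by (rule continuous_on_compose2[OF is_norm_continuous_on[OF nrm, of UNIV] that]) simp
    define e where "e = (\<lambda>t. nrm (x t - y t))"
    have e_cont: "continuous_on {a..t} e" for t
      unfolding e_def
      by (intro nrm_cont continuous_intros continuous_on_subset[OF x] continuous_on_subset[OF y]) auto
    have "e t \<le> \<eta> / C + N / Gamma \<alpha> * ?J (\<lambda>s. e s + R / Gamma \<alpha> * ?J e s) t"
      if t: "t \<in> {a<..T}" for t
    proof -
      have at: "a \<le> t" "a < t" using t by auto
      define P where "P = Psi_pow \<psi> \<gamma> t a *\<^sub>R x0 - Psi_pow \<psi> \<gamma> t a *\<^sub>R y0"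
      have tri: "nrm (u + v) \<le> nrm u + nrm v" for u v
        using nrm by (simp add: is_norm_def)
      have I_diff: "psi_RL_integral a \<psi> \<psi>' \<alpha> g t - psi_RL_integral a \<psi> \<psi>' \<alpha> h t
          = psi_RL_integral a \<psi> \<psi>' \<alpha> (\<lambda>s. g s - h s) t"
        if "continuous_on {a..t} g" "continuous_on {a..t} h" for g h :: "real \<Rightarrow> real ^ 'n"
        using psi_kernel_integral_diff[OF at(1) that] by (simp add: RL flip: scaleR_diff_right)
      have I_le: "nrm (psi_RL_integral a \<psi> \<psi>' \<alpha> g t) \<le> psi_RL_integral a \<psi> \<psi>' \<alpha> h t"
        if "continuous_on {a..t} g" "continuous_on {a..t} h" "\<And>s. s \<in> {a..t} \<Longrightarrow> nrm (g s) \<le> h s"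
        for g :: "real \<Rightarrow> real ^ 'n" and h
        using is_norm_psi_kernel_integral_le[OF nrm at(1) that] nrm Gamma_pos
        by (simp add: RL is_norm_def divide_right_mono)
      have "x t - y t = P + (psi_RL_integral a \<psi> \<psi>' \<alpha> (?F x) t - psi_RL_integral a \<psi> \<psi>' \<alpha> (?F' y) t)"
        using x_sol y_sol at(2) by (simp add: hilfer_solution_def P_def gamma)
      \<comment> \<open>Inserting \<open>?F y\<close> separates the difference of the right-hand
        sides along \<open>y\<close>, which is controlled by the hypothesis \<open>close\<close>,
        from the difference of \<open>?F\<close> along \<open>x\<close> and \<open>y\<close>, which
        the Lipschitz conditions control.\<close>
      also have "\<dots> = P + psi_RL_integral a \<psi> \<psi>' \<alpha> (\<lambda>s. ?F y s - ?F' y s) t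
          + psi_RL_integral a \<psi> \<psi>' \<alpha> (\<lambda>s. ?F x s - ?F y s) t"
        by (simp add: I_diff[OF Fy F'y, symmetric] I_diff[OF Fx Fy, symmetric])
      finally have "x t - y t = P + psi_RL_integral a \<psi> \<psi>' \<alpha> (\<lambda>s. ?F y s - ?F' y s) t
          + psi_RL_integral a \<psi> \<psi>' \<alpha> (\<lambda>s. ?F x s - ?F y s) t" .
      then have "e t \<le> nrm P + nrm (psi_RL_integral a \<psi> \<psi>' \<alpha> (\<lambda>s. ?F y s - ?F' y s) t)
          + nrm (psi_RL_integral a \<psi> \<psi>' \<alpha> (\<lambda>s. ?F x s - ?F y s) t)"
        unfolding e_def by (simp only:) (rule order_trans[OF tri add_right_mono[OF tri]])
      also have "nrm (psi_RL_integral a \<psi> \<psi>' \<alpha> (\<lambda>s. ?F y s - ?F' y s) t)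
          \<le> psi_RL_integral a \<psi> \<psi>' \<alpha> (\<lambda>s. nrm (?F y s - ?F' y s)) t"
        by (intro I_le nrm_cont continuous_intros Fy F'y order_refl)
      \<comment> \<open>The first two contributions together are exactly the quantity assumed to be
        at most the tolerance.\<close>
      also have "nrm P + psi_RL_integral a \<psi> \<psi>' \<alpha> (\<lambda>s. nrm (?F y s - ?F' y s)) t \<le> \<eta> / C"
        using close at(2) by (simp add: P_def)
      also have "nrm (psi_RL_integral a \<psi> \<psi>' \<alpha> (\<lambda>s. ?F x s - ?F y s) t)
          \<le> psi_RL_integral a \<psi> \<psi>' \<alpha> (\<lambda>s. N * (e s + R / Gamma \<alpha> * ?J e s)) t"
      proof (intro I_le continuous_intros Fx Fy e_cont psi_kernel_integral_continuous_on_indep)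
        fix s assume s: "s \<in> {a..t}"
        show "nrm (?F x s - ?F y s) \<le> N * (e s + R / Gamma \<alpha> * ?J e s)"
          unfolding e_def
        proof (rule integro_rhs_lipschitz[OF nrm _ N(1) k_cont f_lipschitz _ x y])
          fix \<sigma> u v assume \<sigma>: "\<sigma> \<in> {a..s}"
          have "nrm (k s \<sigma> u - k s \<sigma> v) \<le> r s \<sigma> * nrm (u - v)"
            using \<sigma> by (intro k_lipschitz) auto
          also have "\<dots> \<le> R * nrm (u - v)"
            using \<sigma> s t nrm by (intro mult_right_mono R) (auto simp: is_norm_def)
          finally show "nrm (k s \<sigma> u - k s \<sigma> v) \<le> R * nrm (u - v)" .
        qed (use s in auto)
      qed
      also have "\<dots> = N / Gamma \<alpha> * ?J (\<lambda>s. e s + R / Gamma \<alpha> * ?J e s) t"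
        unfolding RL psi_kernel_integral_cmult by simp
      finally show ?thesis by simp
    qed
    moreover have "0 \<le> e t" for t
      using nrm by (simp add: e_def is_norm_def)
    ultimately have "e t \<le> C * (\<eta> / C)" if "t \<in> {a..T}" for t
      using \<eta> C(1) that by (intro C(2)[rule_format] e_cont) auto
    then show "(SUP t\<in>{a..T}. nrm (x t - y t)) \<le> \<eta>"
      using T C(1) by (intro cSUP_least) (auto simp: e_def)
  qed
qed

end
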